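(* Let $\bar{x}\in\mathcal{F}$ be an $M$-stationary point of (MPSC) with associated multiplier $(\lambda,\rho,\mu,\nu)$ satisfying the $M$-stationarity system. Define $$\beta_1^1=\{k\in\mathcal{I}_{GH}:\mu_k=0\},\quad \beta_2^1=\{k\in\mathcal{I}_{GH}:\mu_k\ne0\},\quad \beta_1^2=\{k\in\mathcal{I}_{GH}:\nu_k\neq0\},\quad \beta_2^2=\{k\in\mathcal{I}_{GH}:\nu_k=0\}.$$ Then: (a) If $\bar{x}$ is $S$-stationary to (MPSC), then for each $r\in\{1,2\}$, $\bar{x}$ is a KKT point of the branch problem associated with the partition $(\beta_1,\beta_2)=(\beta_1^r,\beta_2^r)$. (b) Conversely, let $r\in\{1,2\}$ and suppose $\bar{x}$ is a KKT point of the branch problem associated with $(\beta_1^r,\beta_2^r)$ with KKT multiplier given by (the corresponding components of) the same vector $(\lambda,\rho,\mu,\nu)$, that is, $$\nabla f(\bar{x})+\sum_{i\in\mathcal{I}_g}\lambda_i\nabla g_i(\bar{x})+\sum_{j=1}^p\rho_j\nabla h_j(\bar{x})+\sum_{k\in\mathcal{I}_G\cup\beta_1^r}\mu_k\nabla G_k(\bar{x})+\sum_{k\in\mathcal{I}_H\cup\beta_2^r}\nu_k\nabla H_k(\bar{x})=0.$$ Then $\bar{x}$ is $S$-stationary to (MPSC).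
   Context: (MPSC) is the problem: minimize $f(x)$ over $x\in\mathbb{R}^n$ subject to $g_i(x)\le 0$ ($i=1,\dots,m$), $h_j(x)=0$ ($j=1,\dots,p$), $G_k(x)H_k(x)=0$ ($k=1,\dots,l$), where $f,g_i,h_j,G_k,H_k:\mathbb{R}^n\to\mathbb{R}$ are twice continuously differentiable. $\mathcal{F}$ denotes its feasible set. For a feasible point $\bar{x}$: $\mathcal{I}_g=\{i: g_i(\bar{x})=0\}$, $\mathcal{I}_G=\{k: G_k(\bar{x})=0,\,H_k(\bar{x})\neq0\}$, $\mathcal{I}_H=\{k: G_k(\bar{x})\ne0,\,H_k(\bar{x})=0\}$, $\mathcal{I}_{GH}=\{k: G_k(\bar{x})=H_k(\bar{x})=0\}$. Lagrangian: $\ell(x,\lambda,\rho,\mu,\nu)=f(x)+\lambda^\top g(x)+\rho^\top h(x)+\mu^\top G(x)+\nu^\top H(x)$. $\bar{x}\in\mathcal{F}$ is $M$-stationary if there is $(\lambda,\rho,\mu,\nu)\in\mathbb{R}^m_+\times\mathbb{R}^p\times\mathbb{R}^l\times\mathbb{R}^l$ satisfying the $M$-stationarity system: $\nabla_x\ell(\bar{x},\lambda,\rho,\mu,\nu)=0$, $\lambda^\top g(\bar{x})=0$, $\mu_k=0$ for $k\in\mathcal{I}_H$, $\nu_k=0$ for $k\in\mathcal{I}_G$, $\mu_k\nu_k=0$ for $k\in\mathcal{I}_{GH}$. It is $S$-stationary if there is such a multiplier vector satisfying the same system with the last condition replaced by $\mu_k=\nu_k=0$ for $k\in\mathcal{I}_{GH}$.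 For a pair $(\beta_1,\beta_2)$ of disjoint (possibly empty) sets with $\beta_1\cup\beta_2=\mathcal{I}_{GH}$, the associated branch problem is the nonlinear program: minimize $f(x)$ subject to $g_i(x)\le0$ ($i=1,\dots,m$), $h_j(x)=0$ ($j=1,\dots,p$), $G_k(x)=0$ ($k\in\mathcal{I}_G\cup\beta_1$), $H_k(x)=0$ ($k\in\mathcal{I}_H\cup\beta_2$). KKT points are meant in the usual sense: existence of multipliers $\lambda_i\ge0$ ($i\in\mathcal{I}_g$), $\rho_j\in\mathbb{R}$, $\mu_k\in\mathbb{R}$ ($k\in\mathcal{I}_G\cup\beta_1$), $\nu_k\in\mathbb{R}$ ($k\in\mathcal{I}_H\cup\beta_2$) such that $\nabla f(\bar{x})+\sum_{i\in\mathcal{I}_g}\lambda_i\nabla g_i(\bar{x})+\sum_{j}\rho_j\nabla h_j(\bar{x})+\sum_{k\in\mathcal{I}_G\cup\beta_1}\mu_k\nabla G_k(\bar{x})+\sum_{k\in\mathcal{I}_H\cup\beta_2}\nu_k\nabla H_k(\bar{x})=0$. *)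

theory Defs
  imports "HOL-Analysis.Analysis"
begin

text \<open>Gradient with respect to the inner product, via the library predicate \<^const>\<open>gderiv\<close>;
  it is unspecified where the function is not differentiable.\<close>

definition gradient :: "('a::real_inner \<Rightarrow> real) \<Rightarrow> 'a \<Rightarrow> 'a" where
  "gradient f x = (THE D. GDERIV f x :> D)"

lemma gradient_eqI:
  assumes "GDERIV f x :> D"
  shows "gradient f x = D"
  unfolding gradient_def
proof (rule the_equality)
  fix D' assume "GDERIV f x :> D'"
  then have "(\<lambda>h. inner h D') = (\<lambda>h. inner h D)"
    using assms unfolding gderiv_def by (rule has_derivative_unique)
  then show "D' = D"
    by (metis vector_eq_ldot)
qed (rule assms)

definition C2_differentiable :: "('a::real_normed_vector \<Rightarrow> real) \<Rightarrow> bool" where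
  "C2_differentiable f \<longleftrightarrow>
     (\<exists>(f' :: 'a \<Rightarrow> ('a \<Rightarrow>\<^sub>L real)) (f'' :: 'a \<Rightarrow> ('a \<Rightarrow>\<^sub>L ('a \<Rightarrow>\<^sub>L real))).
        (\<forall>x. (f has_derivative blinfun_apply (f' x)) (at x)) \<and>
        (\<forall>x. (f' has_derivative blinfun_apply (f'' x)) (at x)) \<and>
        continuous_on UNIV f'')"

text \<open>The constraint families and the multiplier vectors are functions on \<^typ>\<open>nat\<close>, of which
  only the components with index in \<open>{1..m}\<close>, \<open>{1..p}\<close> or \<open>{1..l}\<close> matter. This admits
  \<open>m = 0\<close>, \<open>p = 0\<close> and \<open>l = 0\<close>.\<close>

record 'a mpsc =
  num_ineq   :: nat                       (* m *)
  num_eq     :: nat                       (* p *)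
  num_switch :: nat                       (* l *)
  objf :: "'a \<Rightarrow> real"                    (* f *)
  cg :: "nat \<Rightarrow> 'a \<Rightarrow> real"               (* g *)
  ch :: "nat \<Rightarrow> 'a \<Rightarrow> real"               (* h *)
  cG :: "nat \<Rightarrow> 'a \<Rightarrow> real"               (* G *)
  cH :: "nat \<Rightarrow> 'a \<Rightarrow> real"               (* H *)

definition C2_data :: "'a::real_normed_vector mpsc \<Rightarrow> bool" where
  "C2_data P \<longleftrightarrow>
     C2_differentiable (objf P) \<and>
     (\<forall>i\<in>{1..num_ineq P}. C2_differentiable (cg P i)) \<and>
     (\<forall>j\<in>{1..num_eq P}. C2_differentiable (ch P j)) \<and>
     (\<forall>k\<in>{1..num_switch P}. C2_differentiable (cG P k) \<and> C2_differentiable (cH P k))"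

definition feasible :: "'a mpsc \<Rightarrow> 'a set" where
  "feasible P = {x.
     (\<forall>i\<in>{1..num_ineq P}. cg P i x \<le> 0) \<and>
     (\<forall>j\<in>{1..num_eq P}. ch P j x = 0) \<and>
     (\<forall>k\<in>{1..num_switch P}. cG P k x * cH P k x = 0)}"

definition Ig :: "'a mpsc \<Rightarrow> 'a \<Rightarrow> nat set" where
  "Ig P x = {i\<in>{1..num_ineq P}. cg P i x = 0}"

definition IG :: "'a mpsc \<Rightarrow> 'a \<Rightarrow> nat set" where
  "IG P x = {k\<in>{1..num_switch P}. cG P k x = 0 \<and> cH P k x \<noteq> 0}"

definition IH :: "'a mpsc \<Rightarrow> 'a \<Rightarrow> nat set" where
  "IH P x = {k\<in>{1..num_switch P}. cG P k x \<noteq> 0 \<and> cH P k x = 0}"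

definition IGH :: "'a mpsc \<Rightarrow> 'a \<Rightarrow> nat set" where
  "IGH P x = {k\<in>{1..num_switch P}. cG P k x = 0 \<and> cH P k x = 0}"

definition lagrangian ::
  "'a mpsc \<Rightarrow> 'a \<Rightarrow> (nat \<Rightarrow> real) \<Rightarrow> (nat \<Rightarrow> real) \<Rightarrow> (nat \<Rightarrow> real) \<Rightarrow> (nat \<Rightarrow> real) \<Rightarrow> real" where
  "lagrangian P x lam rho mu nu =
     objf P x
     + (\<Sum>i\<in>{1..num_ineq P}. lam i * cg P i x)
     + (\<Sum>j\<in>{1..num_eq P}. rho j * ch P j x)
     + (\<Sum>k\<in>{1..num_switch P}. mu k * cG P k x)
     + (\<Sum>k\<in>{1..num_switch P}. nu k * cH P k x)"

definition M_system ::
  "'a::euclidean_space mpsc \<Rightarrow> 'a \<Rightarrow>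
    (nat \<Rightarrow> real) \<Rightarrow> (nat \<Rightarrow> real) \<Rightarrow> (nat \<Rightarrow> real) \<Rightarrow> (nat \<Rightarrow> real) \<Rightarrow> bool" where
  "M_system P x lam rho mu nu \<longleftrightarrow>
     (\<forall>i\<in>{1..num_ineq P}. lam i \<ge> 0) \<and>
     gradient (\<lambda>y. lagrangian P y lam rho mu nu) x = 0 \<and>
     (\<Sum>i\<in>{1..num_ineq P}. lam i * cg P i x) = 0 \<and>
     (\<forall>k\<in>IH P x. mu k = 0) \<and>
     (\<forall>k\<in>IG P x. nu k = 0) \<and>
     (\<forall>k\<in>IGH P x. mu k * nu k = 0)"

definition S_system ::
  "'a::euclidean_space mpsc \<Rightarrow> 'a \<Rightarrow>
    (nat \<Rightarrow> real) \<Rightarrow> (nat \<Rightarrow> real) \<Rightarrow> (nat \<Rightarrow> real) \<Rightarrow> (nat \<Rightarrow> real) \<Rightarrow> bool" where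
  "S_system P x lam rho mu nu \<longleftrightarrow>
     (\<forall>i\<in>{1..num_ineq P}. lam i \<ge> 0) \<and>
     gradient (\<lambda>y. lagrangian P y lam rho mu nu) x = 0 \<and>
     (\<Sum>i\<in>{1..num_ineq P}. lam i * cg P i x) = 0 \<and>
     (\<forall>k\<in>IH P x. mu k = 0) \<and>
     (\<forall>k\<in>IG P x. nu k = 0) \<and>
     (\<forall>k\<in>IGH P x. mu k = 0 \<and> nu k = 0)"

definition M_stationary :: "'a::euclidean_space mpsc \<Rightarrow> 'a \<Rightarrow> bool" where
  "M_stationary P x \<longleftrightarrow> x \<in> feasible P \<and> (\<exists>lam rho mu nu. M_system P x lam rho mu nu)"

definition S_stationary :: "'a::euclidean_space mpsc \<Rightarrow> 'a \<Rightarrow> bool" where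
  "S_stationary P x \<longleftrightarrow> x \<in> feasible P \<and> (\<exists>lam rho mu nu. S_system P x lam rho mu nu)"

text \<open>In the branch problem of \<open>P\<close> for the pair \<open>(B1, B2)\<close>, the point \<open>xb\<close> is the one whose
  index sets \<^term>\<open>IG P xb\<close> and \<^term>\<open>IH P xb\<close> determine the constraints. The argument \<open>x\<close> of the
  KKT notions is the candidate point, at which gradients and active inequalities are taken.\<close>

definition branch_feasible :: "'a mpsc \<Rightarrow> 'a \<Rightarrow> nat set \<Rightarrow> nat set \<Rightarrow> 'a set" where
  "branch_feasible P xb B1 B2 = {x.
     (\<forall>i\<in>{1..num_ineq P}. cg P i x \<le> 0) \<and>
     (\<forall>j\<in>{1..num_eq P}. ch P j x = 0) \<and>
     (\<forall>k\<in>IG P xb \<union> B1. cG P k x = 0) \<and>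
     (\<forall>k\<in>IH P xb \<union> B2. cH P k x = 0)}"

definition branch_KKT_multiplier ::
  "'a::euclidean_space mpsc \<Rightarrow> 'a \<Rightarrow> nat set \<Rightarrow> nat set \<Rightarrow> 'a \<Rightarrow>
    (nat \<Rightarrow> real) \<Rightarrow> (nat \<Rightarrow> real) \<Rightarrow> (nat \<Rightarrow> real) \<Rightarrow> (nat \<Rightarrow> real) \<Rightarrow> bool" where
  "branch_KKT_multiplier P xb B1 B2 x lam rho mu nu \<longleftrightarrow>
     (\<forall>i\<in>Ig P x. lam i \<ge> 0) \<and>
     gradient (objf P) x
     + (\<Sum>i\<in>Ig P x. lam i *\<^sub>R gradient (cg P i) x)
     + (\<Sum>j\<in>{1..num_eq P}. rho j *\<^sub>R gradient (ch P j) x)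
     + (\<Sum>k\<in>IG P xb \<union> B1. mu k *\<^sub>R gradient (cG P k) x)
     + (\<Sum>k\<in>IH P xb \<union> B2. nu k *\<^sub>R gradient (cH P k) x) = 0"

definition branch_KKT_point ::
  "'a::euclidean_space mpsc \<Rightarrow> 'a \<Rightarrow> nat set \<Rightarrow> nat set \<Rightarrow> 'a \<Rightarrow> bool" where
  "branch_KKT_point P xb B1 B2 x \<longleftrightarrow>
     x \<in> branch_feasible P xb B1 B2 \<and>
     (\<exists>lam rho mu nu. branch_KKT_multiplier P xb B1 B2 x lam rho mu nu)"

text \<open>\<open>beta1 P x mu nu r\<close> and \<open>beta2 P x mu nu r\<close> stand for $\beta_1^r$ and $\beta_2^r$; they are
  meant for \<open>r = 1\<close> and \<open>r = 2\<close>.\<close>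

definition beta1 :: "'a mpsc \<Rightarrow> 'a \<Rightarrow> (nat \<Rightarrow> real) \<Rightarrow> (nat \<Rightarrow> real) \<Rightarrow> nat \<Rightarrow> nat set" where
  "beta1 P x mu nu r = (if r = 1 then {k\<in>IGH P x. mu k = 0} else {k\<in>IGH P x. nu k \<noteq> 0})"

definition beta2 :: "'a mpsc \<Rightarrow> 'a \<Rightarrow> (nat \<Rightarrow> real) \<Rightarrow> (nat \<Rightarrow> real) \<Rightarrow> nat \<Rightarrow> nat set" where
  "beta2 P x mu nu r = (if r = 1 then {k\<in>IGH P x. mu k \<noteq> 0} else {k\<in>IGH P x. nu k = 0})"

lemma beta_partition:
  "beta1 P x mu nu r \<inter> beta2 P x mu nu r = {}"
  "beta1 P x mu nu r \<union> beta2 P x mu nu r = IGH P x"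
  by (auto simp: beta1_def beta2_def)

end

theory Submission
  imports Defs
begin

text \<open>
  The branch problem for \<open>(\<beta>\<^sub>1, \<beta>\<^sub>2)\<close> has the constraints \<open>G\<^sub>k = 0\<close> for \<open>k \<in> I\<^sub>G\<close> and \<open>H\<^sub>k = 0\<close> for
  \<open>k \<in> I\<^sub>H\<close>, and in addition one constraint for each biactive index. S-stationarity says that the
  biactive indices carry no multiplier at all, so it is the KKT condition of the problem in which
  these additional constraints are dropped, that is, the branch KKT condition for the pair
  \<open>({}, {})\<close>. This is \<open>S_stationary_iff_KKT_empty_branch\<close>; it uses that at a feasible point
  complementary slackness forces \<open>\<lambda>\<^sub>i = 0\<close> for inactive \<open>i\<close>.

  A multiplier for \<open>({}, {})\<close> becomes one for every \<open>(\<beta>\<^sub>1, \<beta>\<^sub>2)\<close> after extension by zero, which gives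
  (a). For (b), the partitions are chosen such that the multiplier that the branch equation
  attaches to a biactive index is zero: for \<open>r = 1\<close>, \<open>\<mu>\<close> vanishes on \<open>\<beta>\<^sub>1\<close> by definition, while on
  \<open>\<beta>\<^sub>2\<close> it is nonzero, so that \<open>\<mu>\<^sub>k\<nu>\<^sub>k = 0\<close> gives \<open>\<nu>\<^sub>k = 0\<close>; \<open>r = 2\<close> is the same with the roles of \<open>\<mu>\<close>
  and \<open>\<nu>\<close> exchanged. Hence the additional terms drop out of the branch equation, and the given
  multiplier already solves the equation for \<open>({}, {})\<close>.
\<close>

lemma C2_differentiable_GDERIV_gradient:
  fixes f :: "'a::euclidean_space \<Rightarrow> real"
  assumes "C2_differentiable f"
  shows "GDERIV f x :> gradient f x"
proof -
  obtain L :: "'a \<Rightarrow>\<^sub>L real" where L: "(f has_derivative blinfun_apply L) (at x)"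
    using assms unfolding C2_differentiable_def by blast
  \<comment> \<open>The Riesz representative of the derivative.\<close>
  define D where "D = (\<Sum>b\<in>Basis. blinfun_apply L b *\<^sub>R b)"
  have "blinfun_apply L = (\<lambda>h. inner h D)"
  proof
    fix h
    have "blinfun_apply L h = blinfun_apply L (\<Sum>b\<in>Basis. inner h b *\<^sub>R b)"
      by (simp add: euclidean_representation)
    also have "\<dots> = inner h D"
      by (simp add: D_def inner_sum_right blinfun.sum_right blinfun.scaleR_right mult.commute)
    finally show "blinfun_apply L h = inner h D" .
  qed
  with L have "GDERIV f x :> D"
    by (simp add: gderiv_def)
  then show ?thesis
    by (simp add: gradient_eqI)
qed

lemma GDERIV_weighted_sum:
  assumes "\<And>i. i \<in> A \<Longrightarrow> GDERIV (f i) x :> D i"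
  shows "GDERIV (\<lambda>y. \<Sum>i\<in>A. c i * f i y) x :> (\<Sum>i\<in>A. c i *\<^sub>R D i)"
  using assms unfolding gderiv_def
  by (auto simp: inner_sum_right intro!: has_derivative_sum has_derivative_mult_right)

lemma gradient_lagrangian:
  fixes P :: "'a::euclidean_space mpsc"
  assumes "C2_data P"
  shows "gradient (\<lambda>y. lagrangian P y lam rho mu nu) x =
     gradient (objf P) x
     + (\<Sum>i\<in>{1..num_ineq P}. lam i *\<^sub>R gradient (cg P i) x)
     + (\<Sum>j\<in>{1..num_eq P}. rho j *\<^sub>R gradient (ch P j) x)
     + (\<Sum>k\<in>{1..num_switch P}. mu k *\<^sub>R gradient (cG P k) x)
     + (\<Sum>k\<in>{1..num_switch P}. nu k *\<^sub>R gradient (cH P k) x)"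
  using assms unfolding lagrangian_def C2_data_def
  by (intro gradient_eqI GDERIV_add GDERIV_weighted_sum C2_differentiable_GDERIV_gradient) auto

text \<open>At a feasible point all terms of \<open>\<lambda>\<^sup>T g\<close> have the same sign, so the sum vanishes only
  termwise.\<close>

lemma inactive_multiplier_zero:
  assumes "x \<in> feasible P" and "\<forall>i\<in>{1..num_ineq P}. lam i \<ge> 0"
    and "(\<Sum>i\<in>{1..num_ineq P}. lam i * cg P i x) = 0"
    and "i \<in> {1..num_ineq P} - Ig P x"
  shows "lam i = 0"
proof -
  have "\<forall>i\<in>{1..num_ineq P}. lam i * cg P i x \<le> 0"
    using assms(1,2) by (auto simp: feasible_def mult_nonneg_nonpos)
  then have "\<forall>i\<in>{1..num_ineq P}. lam i * cg P i x = 0"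
    using assms(3) sum_nonneg_eq_0_iff[of "{1..num_ineq P}" "\<lambda>i. - (lam i * cg P i x)"]
    by (simp add: sum_negf)
  with assms(4) show ?thesis
    by (auto simp: Ig_def)
qed

text \<open>At a feasible point every index \<open>k \<le> l\<close> lies in exactly one of \<open>I\<^sub>G\<close>, \<open>I\<^sub>H\<close> and \<open>I\<^sub>G\<^sub>H\<close>; the
  S-system therefore leaves \<open>\<mu>\<close> supported on \<open>I\<^sub>G\<close> and \<open>\<nu>\<close> on \<open>I\<^sub>H\<close>. Conversely, KKT multipliers of
  the relaxed problem need not vanish off the index sets that occur in the equation, and are
  truncated there.\<close>

lemma S_stationary_iff_KKT_empty_branch:
  fixes P :: "'a::euclidean_space mpsc"
  assumes C2: "C2_data P" and feas: "x \<in> feasible P"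
  shows "S_stationary P x \<longleftrightarrow>
    (\<exists>lam rho mu nu. branch_KKT_multiplier P x {} {} x lam rho mu nu)"
proof
  assume "S_stationary P x"
  then obtain lam rho mu nu where S: "S_system P x lam rho mu nu"
    unfolding S_stationary_def by blast
  have lam: "\<forall>i\<in>{1..num_ineq P} - Ig P x. lam i = 0"
    using inactive_multiplier_zero[OF feas] S unfolding S_system_def by blast
  have mu: "\<forall>k\<in>{1..num_switch P} - IG P x. mu k = 0"
    and nu: "\<forall>k\<in>{1..num_switch P} - IH P x. nu k = 0"
    using S feas unfolding S_system_def IG_def IH_def IGH_def feasible_def by auto
  have "(\<Sum>i\<in>Ig P x. lam i *\<^sub>R gradient (cg P i) x)
      = (\<Sum>i\<in>{1..num_ineq P}. lam i *\<^sub>R gradient (cg P i) x)"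
    using lam by (intro sum.mono_neutral_left) (auto simp: Ig_def)
  moreover have "(\<Sum>k\<in>IG P x. mu k *\<^sub>R gradient (cG P k) x)
      = (\<Sum>k\<in>{1..num_switch P}. mu k *\<^sub>R gradient (cG P k) x)"
    using mu by (intro sum.mono_neutral_left) (auto simp: IG_def)
  moreover have "(\<Sum>k\<in>IH P x. nu k *\<^sub>R gradient (cH P k) x)
      = (\<Sum>k\<in>{1..num_switch P}. nu k *\<^sub>R gradient (cH P k) x)"
    using nu by (intro sum.mono_neutral_left) (auto simp: IH_def)
  ultimately have "branch_KKT_multiplier P x {} {} x lam rho mu nu"
    using S unfolding branch_KKT_multiplier_def S_system_def gradient_lagrangian[OF C2]
    by (simp add: Ig_def)
  then show "\<exists>lam rho mu nu. branch_KKT_multiplier P x {} {} x lam rho mu nu"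
    by blast
next
  assume "\<exists>lam rho mu nu. branch_KKT_multiplier P x {} {} x lam rho mu nu"
  then obtain lam rho mu nu where K: "branch_KKT_multiplier P x {} {} x lam rho mu nu"
    by blast
  define lam' where "lam' i = (if i \<in> Ig P x then lam i else 0)" for i
  define mu' where "mu' k = (if k \<in> IG P x then mu k else 0)" for k
  define nu' where "nu' k = (if k \<in> IH P x then nu k else 0)" for k
  have "(\<Sum>i\<in>{1..num_ineq P}. lam' i *\<^sub>R gradient (cg P i) x)
      = (\<Sum>i\<in>Ig P x. lam i *\<^sub>R gradient (cg P i) x)"
    by (rule sum.mono_neutral_cong_right) (auto simp: lam'_def Ig_def)
  moreover have "(\<Sum>k\<in>{1..num_switch P}. mu' k *\<^sub>R gradient (cG P k) x)
      = (\<Sum>k\<in>IG P x. mu k *\<^sub>R gradient (cG P k) x)"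
    by (rule sum.mono_neutral_cong_right) (auto simp: mu'_def IG_def)
  moreover have "(\<Sum>k\<in>{1..num_switch P}. nu' k *\<^sub>R gradient (cH P k) x)
      = (\<Sum>k\<in>IH P x. nu k *\<^sub>R gradient (cH P k) x)"
    by (rule sum.mono_neutral_cong_right) (auto simp: nu'_def IH_def)
  ultimately have "gradient (\<lambda>y. lagrangian P y lam' rho mu' nu') x = 0"
    using K unfolding branch_KKT_multiplier_def gradient_lagrangian[OF C2] by simp
  moreover have "(\<Sum>i\<in>{1..num_ineq P}. lam' i * cg P i x) = 0"
    by (rule sum.neutral) (auto simp: lam'_def Ig_def)
  moreover have "\<forall>i\<in>{1..num_ineq P}. lam' i \<ge> 0"
    using K by (auto simp: lam'_def branch_KKT_multiplier_def)
  ultimately have "S_system P x lam' rho mu' nu'"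
    unfolding S_system_def by (auto simp: mu'_def nu'_def IG_def IH_def IGH_def)
  with feas show "S_stationary P x"
    unfolding S_stationary_def by blast
qed

lemma branch_KKT_multiplier_drop_zeros:
  assumes "B1 \<subseteq> IGH P x" "B2 \<subseteq> IGH P x"
    and "\<forall>k\<in>B1. mu k = 0" "\<forall>k\<in>B2. nu k = 0"
  shows "branch_KKT_multiplier P x B1 B2 x lam rho mu nu \<longleftrightarrow>
    branch_KKT_multiplier P x {} {} x lam rho mu nu"
proof -
  have "IG P x \<union> B1 \<subseteq> {1..num_switch P}" "IH P x \<union> B2 \<subseteq> {1..num_switch P}"
    using assms(1,2) by (auto simp: IG_def IH_def IGH_def)
  then have fin: "finite (IG P x \<union> B1)" "finite (IH P x \<union> B2)"
    by (auto intro: finite_subset)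
  have "(\<Sum>k\<in>IG P x \<union> B1. mu k *\<^sub>R gradient (cG P k) x)
      = (\<Sum>k\<in>IG P x. mu k *\<^sub>R gradient (cG P k) x)"
    using fin assms(3) by (intro sum.mono_neutral_right) auto
  moreover have "(\<Sum>k\<in>IH P x \<union> B2. nu k *\<^sub>R gradient (cH P k) x)
      = (\<Sum>k\<in>IH P x. nu k *\<^sub>R gradient (cH P k) x)"
    using fin assms(4) by (intro sum.mono_neutral_right) auto
  ultimately show ?thesis
    unfolding branch_KKT_multiplier_def by simp
qed

lemma S_stationary_imp_branch_KKT_point:
  fixes P :: "'a::euclidean_space mpsc"
  assumes C2: "C2_data P" and S: "S_stationary P x"
    and B: "B1 \<subseteq> IGH P x" "B2 \<subseteq> IGH P x"
  shows "branch_KKT_point P x B1 B2 x"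
proof -
  have feas: "x \<in> feasible P"
    using S unfolding S_stationary_def by blast
  obtain lam rho mu nu where K: "branch_KKT_multiplier P x {} {} x lam rho mu nu"
    using S S_stationary_iff_KKT_empty_branch[OF C2 feas] by blast
  \<comment> \<open>The equation for \<open>({}, {})\<close> leaves \<open>mu\<close> and \<open>nu\<close> arbitrary at the biactive indices.\<close>
  define mu' where "mu' k = (if k \<in> IG P x then mu k else 0)" for k
  define nu' where "nu' k = (if k \<in> IH P x then nu k else 0)" for k
  have "branch_KKT_multiplier P x {} {} x lam rho mu' nu'"
    using K by (simp add: branch_KKT_multiplier_def mu'_def nu'_def)
  moreover have "\<forall>k\<in>B1. mu' k = 0" "\<forall>k\<in>B2. nu' k = 0"
    using B by (auto simp: mu'_def nu'_def IG_def IH_def IGH_def)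
  ultimately have "branch_KKT_multiplier P x B1 B2 x lam rho mu' nu'"
    using branch_KKT_multiplier_drop_zeros[OF B] by blast
  moreover have "x \<in> branch_feasible P x B1 B2"
    using feas B by (auto simp: branch_feasible_def feasible_def IG_def IH_def IGH_def)
  ultimately show ?thesis
    unfolding branch_KKT_point_def by blast
qed

theorem theorem4p1:
  fixes P :: "(real ^ 'n) mpsc"
    and xbar :: "real ^ 'n"
    and lam rho mu nu :: "nat \<Rightarrow> real"
  assumes "C2_data P"
    and "M_stationary P xbar"
    and "M_system P xbar lam rho mu nu"
  shows
    "(S_stationary P xbar \<longrightarrow>
        (\<forall>r\<in>{1, 2}. branch_KKT_point P xbar (beta1 P xbar mu nu r) (beta2 P xbar mu nu r) xbar))
     \<and>
     (\<forall>r\<in>{1, 2}.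
        branch_KKT_point P xbar (beta1 P xbar mu nu r) (beta2 P xbar mu nu r) xbar \<and>
        branch_KKT_multiplier P xbar (beta1 P xbar mu nu r) (beta2 P xbar mu nu r) xbar
          lam rho mu nu
        \<longrightarrow> S_stationary P xbar)"
proof (intro conjI impI ballI)
  have B: "beta1 P xbar mu nu r \<subseteq> IGH P xbar" "beta2 P xbar mu nu r \<subseteq> IGH P xbar" for r
    using beta_partition(2)[of P xbar mu nu r] by auto
  show "branch_KKT_point P xbar (beta1 P xbar mu nu r) (beta2 P xbar mu nu r) xbar"
    if "S_stationary P xbar" for r
    using S_stationary_imp_branch_KKT_point[OF assms(1) that B] .
  show "S_stationary P xbar"
    if "branch_KKT_point P xbar (beta1 P xbar mu nu r) (beta2 P xbar mu nu r) xbar \<and>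
        branch_KKT_multiplier P xbar (beta1 P xbar mu nu r) (beta2 P xbar mu nu r) xbar
          lam rho mu nu" for r
  proof -
    have feas: "xbar \<in> feasible P"
      using assms(2) unfolding M_stationary_def by blast
    \<comment> \<open>Here the M-condition \<open>\<mu>\<^sub>k \<nu>\<^sub>k = 0\<close> enters.\<close>
    have "\<forall>k\<in>beta1 P xbar mu nu r. mu k = 0" "\<forall>k\<in>beta2 P xbar mu nu r. nu k = 0"
      using assms(3) by (auto simp: M_system_def beta1_def beta2_def)
    then have "branch_KKT_multiplier P xbar {} {} xbar lam rho mu nu"
      using that branch_KKT_multiplier_drop_zeros[OF B] by blast
    then show ?thesis
      using S_stationary_iff_KKT_empty_branch[OF assms(1) feas] by blast
  qed
qed

end
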